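(* Let $J$ be a complex structure on a $6$-dimensional $3$-step nilpotent Lie algebra $\mathfrak{g}$ admitting a basis $\{\omega^1,\omega^2,\omega^3\}$ of $\mathfrak{g}^{1,0}$ with $$d\omega^1=0,\qquad d\omega^2=\omega^{1\bar1},\qquad d\omega^3=\omega^{12}+B\,\omega^{1\bar 2}+c\,\omega^{2\bar 1},$$ where $B\in\mathbb{C}$, $c\in\mathbb{R}$, $c\ge0$, $c\neq|B-1|$ and $(c,|B|)\neq(0,1)$. Then: (i) $\mathfrak{g}\cong\mathfrak{h}_{13}$ if and only if $c^4-2(|B|^2+1)c^2+(|B|^2-1)^2<0$; (ii) $\mathfrak{g}\cong\mathfrak{h}_{14}$ if and only if $c^4-2(|B|^2+1)c^2+(|B|^2-1)^2=0$; (iii) $\mathfrak{g}\cong\mathfrak{h}_{15}$ if and only if $c^4-2(|B|^2+1)c^2+(|B|^2-1)^2>0$.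
   Context: A complex structure on a real Lie algebra $\mathfrak{g}$ is an endomorphism $J$ with $J^2=-\mathrm{Id}$ and $[JX,JY]=J[JX,Y]+J[X,JY]+[X,Y]$ for all $X,Y$. $\mathfrak{g}^{1,0}\subset\mathfrak{g}_{\mathbb{C}}^*$ is the $i$-eigenspace of $J$ acting on $\mathfrak{g}_{\mathbb{C}}^*$; $d$ is the Chevalley–Eilenberg differential. Notation: $\omega^{jk}=\omega^j\wedge\omega^k$, $\omega^{j\bar k}=\omega^j\wedge\overline{\omega^k}$. The real Lie algebras are described by the differentials of a basis $e^1,\dots,e^6$ of the dual, with $ij$ denoting $e^i\wedge e^j$ (the $k$-th entry is $de^k$): $\mathfrak{h}_{13}=(0,0,0,12,13+14,24)$, $\mathfrak{h}_{14}=(0,0,0,12,14,13+42)$, $\mathfrak{h}_{15}=(0,0,0,12,13+42,14+23)$. *)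

theory Defs
  imports "HOL-Analysis.Analysis" "HOL-Library.Function_Algebras"
begin

definition lie_algebra :: "('g::real_vector \<Rightarrow> 'g \<Rightarrow> 'g) \<Rightarrow> bool" where
  "lie_algebra br \<longleftrightarrow> bilinear br \<and> (\<forall>X. br X X = 0) \<and>
     (\<forall>X Y Z. br X (br Y Z) + br Y (br Z X) + br Z (br X Y) = 0)"

definition lie_isomorphic ::
    "('g::real_vector \<Rightarrow> 'g \<Rightarrow> 'g) \<Rightarrow> ('h::real_vector \<Rightarrow> 'h \<Rightarrow> 'h) \<Rightarrow> bool" where
  "lie_isomorphic br br' \<longleftrightarrow>
     (\<exists>f. linear f \<and> bij f \<and> (\<forall>X Y. f (br X Y) = br' (f X) (f Y)))"

primrec lower_central :: "('g::real_vector \<Rightarrow> 'g \<Rightarrow> 'g) \<Rightarrow> nat \<Rightarrow> 'g set" where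
  "lower_central br 0 = UNIV"
| "lower_central br (Suc k) = span {br X Y | X Y. Y \<in> lower_central br k}"

definition nilpotent_step :: "('g::real_vector \<Rightarrow> 'g \<Rightarrow> 'g) \<Rightarrow> nat \<Rightarrow> bool" where
  "nilpotent_step br s \<longleftrightarrow>
     lower_central br s = {0} \<and> (\<forall>k<s. lower_central br k \<noteq> {0})"

definition complex_structure ::
    "('g::real_vector \<Rightarrow> 'g \<Rightarrow> 'g) \<Rightarrow> ('g \<Rightarrow> 'g) \<Rightarrow> bool" where
  "complex_structure br J \<longleftrightarrow> linear J \<and> (\<forall>X. J (J X) = - X) \<and>
     (\<forall>X Y. br (J X) (J Y) = J (br (J X) Y) + J (br X (J Y)) + br X Y)"

text \<open>The dual of the complexification is represented as the complex vector space of
  real-linear maps from the Lie algebra to the complex numbers (a complex-linear functional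
  on the complexification is determined by its restriction to the real Lie algebra).
  Likewise, complex 2-forms are represented by their values on real vectors.
  Conjugation of forms is then pointwise conjugation.\<close>

definition complexified_dual :: "('g::real_vector \<Rightarrow> complex) set" where
  "complexified_dual = {\<alpha>. linear \<alpha>}"

definition cscale :: "complex \<Rightarrow> ('g \<Rightarrow> complex) \<Rightarrow> 'g \<Rightarrow> complex" where
  "cscale a \<alpha> = (\<lambda>X. a * \<alpha> X)"

interpretation cfun: vector_space "cscale :: complex \<Rightarrow> ('g \<Rightarrow> complex) \<Rightarrow> 'g \<Rightarrow> complex"
  by unfold_locales (auto simp: cscale_def fun_eq_iff algebra_simps)

text \<open>\<open>J\<close> acts on forms by precomposition, so that \<open>forms10 J\<close> consists of the forms that
  are complex-linear with respect to \<open>J\<close>.\<close>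

definition dual_action :: "('g \<Rightarrow> 'g) \<Rightarrow> ('g \<Rightarrow> complex) \<Rightarrow> 'g \<Rightarrow> complex" where
  "dual_action J \<alpha> = (\<lambda>X. \<alpha> (J X))"

definition forms10 :: "('g::real_vector \<Rightarrow> 'g) \<Rightarrow> ('g \<Rightarrow> complex) set" where
  "forms10 J = {\<alpha> \<in> complexified_dual. dual_action J \<alpha> = cscale \<i> \<alpha>}"

definition basis10 ::
    "('g::real_vector \<Rightarrow> 'g) \<Rightarrow> ('g \<Rightarrow> complex) \<Rightarrow> ('g \<Rightarrow> complex) \<Rightarrow> ('g \<Rightarrow> complex) \<Rightarrow> bool" where
  "basis10 J w1 w2 w3 \<longleftrightarrow> distinct [w1, w2, w3] \<and>
     cfun.independent {w1, w2, w3} \<and> cfun.span {w1, w2, w3} = forms10 J"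

definition conj_form :: "('g \<Rightarrow> complex) \<Rightarrow> 'g \<Rightarrow> complex" where
  "conj_form \<alpha> = (\<lambda>X. cnj (\<alpha> X))"

definition ce_d :: "('g \<Rightarrow> 'g \<Rightarrow> 'g) \<Rightarrow> ('g \<Rightarrow> 'k::comm_ring_1) \<Rightarrow> 'g \<Rightarrow> 'g \<Rightarrow> 'k" where
  "ce_d br \<alpha> = (\<lambda>X Y. - \<alpha> (br X Y))"

definition wedge ::
    "('g \<Rightarrow> 'k::comm_ring_1) \<Rightarrow> ('g \<Rightarrow> 'k) \<Rightarrow> 'g \<Rightarrow> 'g \<Rightarrow> 'k" (infixr "\<and>\<^sub>f" 70) where
  "\<alpha> \<and>\<^sub>f \<beta> = (\<lambda>X Y. \<alpha> X * \<beta> Y - \<alpha> Y * \<beta> X)"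

text \<open>The concrete algebras live on \<open>real^6\<close>, whose six coordinates are indexed by the numerals
  \<open>1, \<dots>, 6\<close> of type \<open>6\<close> (where \<open>6\<close> coincides with \<open>0\<close>). The covectors \<open>e k\<close> are the dual
  of the standard basis, and the bracket is determined by prescribing the 2-forms
  \<open>d (e k)\<close>; see \<open>ce_d_bracket_of\<close>.\<close>

definition e :: "6 \<Rightarrow> real^6 \<Rightarrow> real" where
  "e k = (\<lambda>x. x $ k)"

definition ee :: "6 \<Rightarrow> 6 \<Rightarrow> real^6 \<Rightarrow> real^6 \<Rightarrow> real" where
  "ee i j = e i \<and>\<^sub>f e j"

definition bracket_of :: "(6 \<Rightarrow> real^6 \<Rightarrow> real^6 \<Rightarrow> real) \<Rightarrow> real^6 \<Rightarrow> real^6 \<Rightarrow> real^6" where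
  "bracket_of de = (\<lambda>x y. \<chi> k. - de k x y)"

definition h13 :: "real^6 \<Rightarrow> real^6 \<Rightarrow> real^6" where
  "h13 = bracket_of ((\<lambda>_. 0)(4 := ee 1 2, 5 := ee 1 3 + ee 1 4, 6 := ee 2 4))"

definition h14 :: "real^6 \<Rightarrow> real^6 \<Rightarrow> real^6" where
  "h14 = bracket_of ((\<lambda>_. 0)(4 := ee 1 2, 5 := ee 1 4, 6 := ee 1 3 + ee 4 2))"

definition h15 :: "real^6 \<Rightarrow> real^6 \<Rightarrow> real^6" where
  "h15 = bracket_of ((\<lambda>_. 0)(4 := ee 1 2, 5 := ee 1 3 + ee 4 2, 6 := ee 1 4 + ee 2 3))"

lemma ce_d_bracket_of: "ce_d (bracket_of de) (e k) = de k"
  by (simp add: ce_d_def bracket_of_def e_def)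

lemma lie_algebra_h13: "lie_algebra h13"
  unfolding lie_algebra_def bilinear_def linear_iff h13_def bracket_of_def
  by (auto simp: vec_eq_iff ee_def wedge_def e_def algebra_simps)

lemma lie_algebra_h14: "lie_algebra h14"
  unfolding lie_algebra_def bilinear_def linear_iff h14_def bracket_of_def
  by (auto simp: vec_eq_iff ee_def wedge_def e_def algebra_simps)

lemma lie_algebra_h15: "lie_algebra h15"
  unfolding lie_algebra_def bilinear_def linear_iff h15_def bracket_of_def
  by (auto simp: vec_eq_iff ee_def wedge_def e_def algebra_simps)

end

theory Submission
  imports Defs
begin

text \<open>Write \<open>w1 = a1 + \<i> a2\<close> and \<open>w2 = a3 + \<i> a4\<close>. Up to multiples of \<open>d a4\<close>, which is
  proportional to \<open>a1 \<and> a2\<close>, the forms \<open>d Re (l w3)\<close> with \<open>l\<close> complex are a pencil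
  \<open>p \<and> a3 + q \<and> a4\<close> with \<open>p, q\<close> in the span of \<open>a1, a2\<close>. The condition \<open>c \<noteq> |B - 1|\<close> says that
  \<open>l \<mapsto> q\<close> is bijective, so that the pencil is an endomorphism \<open>q \<mapsto> p\<close> of the plane. Replacing
  \<open>a4\<close> by \<open>a4 - t a3\<close> makes it traceless, and \<open>(c, |B|) \<noteq> (0, 1)\<close> says that it is not a scalar.
  Such endomorphisms are classified up to conjugation and scaling by the sign of their
  determinant, and this is the sign of the quantity in the statement.

  Conversely, the zero directions of the determinant are recovered from the bracket as the
  elements annihilated by a noncentral element of the centralizer of the derived algebra: two
  lines for \<open>h13\<close>, one line for \<open>h14\<close> and none for \<open>h15\<close> (modulo that centralizer).\<close>

section \<open>Coframes\<close>

lemma exhaust_6: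
  fixes k :: 6
  shows "k = 1 \<or> k = 2 \<or> k = 3 \<or> k = 4 \<or> k = 5 \<or> k = 6"
proof (induct k)
  case (of_int z)
  \<comment> \<open>The representative 0 stands for the numeral 6.\<close>
  then have "z = 0 \<or> z = 1 \<or> z = 2 \<or> z = 3 \<or> z = 4 \<or> z = 5"
    by auto
  then show ?case
    by auto
qed

lemma forall_6: "(\<forall>k::6. P k) \<longleftrightarrow> P 1 \<and> P 2 \<and> P 3 \<and> P 4 \<and> P 5 \<and> P 6"
  by (metis exhaust_6)

text \<open>The domain is an abstract real vector space, of which only \<open>dim\<close> is known.
  A basis of it is sent to an independent set of \<open>DIM('b)\<close> vectors, which must
  span.\<close>

lemma linear_injective_imp_surjective_dim:
  fixes f :: "'a::real_vector \<Rightarrow> 'b::euclidean_space"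
  assumes "linear f" "inj f" "dim (UNIV :: 'a set) = DIM('b)"
  shows "surj f"
proof -
  obtain S where S: "independent (S :: 'a set)" "span S = UNIV" "card S = DIM('b)"
    using assms(3) by (metis basis_exists span_UNIV span_eq top_greatest top.extremum_unique)
  have "independent (f ` S)"
    using linear_independent_injective_image[OF assms(1) S(1)] assms(2) inj_on_subset by blast
  moreover have "card (f ` S) = DIM('b)"
    using S(3) assms(2) by (metis card_image inj_on_subset top_greatest)
  ultimately have "UNIV \<subseteq> span (f ` S)"
    by (intro card_ge_dim_independent) (auto simp: dim_UNIV)
  then show ?thesis
    using linear_span_image[OF assms(1), of S] S(2) by auto
qed

definition coordinates6 ::
    "('g \<Rightarrow> real) \<Rightarrow> ('g \<Rightarrow> real) \<Rightarrow> ('g \<Rightarrow> real) \<Rightarrow> ('g \<Rightarrow> real) \<Rightarrow> ('g \<Rightarrow> real) \<Rightarrow> ('g \<Rightarrow> real)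
      \<Rightarrow> 'g \<Rightarrow> real^6" where
  "coordinates6 f1 f2 f3 f4 f5 f6 X = (\<chi> k.
     ((\<lambda>_. 0)(1 := f1 X, 2 := f2 X, 3 := f3 X, 4 := f4 X, 5 := f5 X, 6 := f6 X)) k)"

lemma coordinates6_nth [simp]:
  "coordinates6 f1 f2 f3 f4 f5 f6 X $ 1 = f1 X"
  "coordinates6 f1 f2 f3 f4 f5 f6 X $ 2 = f2 X"
  "coordinates6 f1 f2 f3 f4 f5 f6 X $ 3 = f3 X"
  "coordinates6 f1 f2 f3 f4 f5 f6 X $ 4 = f4 X"
  "coordinates6 f1 f2 f3 f4 f5 f6 X $ 5 = f5 X"
  "coordinates6 f1 f2 f3 f4 f5 f6 X $ 6 = f6 X"
  by (simp_all add: coordinates6_def)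

text \<open>In dimension 6, trivial common kernel means that the six covectors form a basis of the
  dual; this form gives injectivity of the coordinate map directly.\<close>

definition coframe6 ::
    "('g::real_vector \<Rightarrow> real) \<Rightarrow> ('g \<Rightarrow> real) \<Rightarrow> ('g \<Rightarrow> real) \<Rightarrow> ('g \<Rightarrow> real) \<Rightarrow> ('g \<Rightarrow> real)
      \<Rightarrow> ('g \<Rightarrow> real) \<Rightarrow> bool" where
  "coframe6 f1 f2 f3 f4 f5 f6 \<longleftrightarrow> dim (UNIV :: 'g set) = 6 \<and>
     linear f1 \<and> linear f2 \<and> linear f3 \<and> linear f4 \<and> linear f5 \<and> linear f6 \<and>
     (\<forall>X. f1 X = 0 \<and> f2 X = 0 \<and> f3 X = 0 \<and> f4 X = 0 \<and> f5 X = 0 \<and> f6 X = 0 \<longrightarrow> X = 0)"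

text \<open>Structure equations determine the bracket, so the coordinate map of the coframe is the
  isomorphism. With \<open>X\<close> fixed, \<open>ce_d br f1 X\<close> is a function of
  \<open>Y\<close>, so \<open>coordinates6\<close> also collects the six differentials into one
  vector.\<close>

lemma lie_isomorphic_bracket_of:
  assumes "coframe6 f1 f2 f3 f4 f5 f6"
    and "\<And>X Y. coordinates6 (ce_d br f1 X) (ce_d br f2 X) (ce_d br f3 X)
                  (ce_d br f4 X) (ce_d br f5 X) (ce_d br f6 X) Y
           = (\<chi> k. de k (coordinates6 f1 f2 f3 f4 f5 f6 X) (coordinates6 f1 f2 f3 f4 f5 f6 Y))"
  shows "lie_isomorphic br (bracket_of de)"
proof -
  let ?f = "coordinates6 f1 f2 f3 f4 f5 f6"
  have lin: "linear ?f"
    using assms(1) by (simp add: coframe6_def linear_iff vec_eq_iff forall_6)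
  moreover have "inj ?f"
    unfolding linear_injective_0[OF lin]
    using assms(1) by (simp add: coframe6_def vec_eq_iff forall_6)
  moreover have "surj ?f"
    by (rule linear_injective_imp_surjective_dim)
      (use calculation assms(1) in \<open>auto simp: coframe6_def\<close>)
  moreover have "?f (br X Y) = bracket_of de (?f X) (?f Y)" for X Y
    using assms(2)[of X Y]
    by (simp add: vec_eq_iff forall_6 ce_d_def bracket_of_def minus_equation_iff eq_commute)
  ultimately show ?thesis
    unfolding lie_isomorphic_def bij_def by blast
qed

lemmas h_simps = bracket_of_def ee_def wedge_def e_def vec_eq_iff forall_6

section \<open>Recognizing the three algebras by structure equations\<close>

lemma lie_isomorphic_h13:
  assumes "coframe6 f1 f2 f3 f4 f5 f6"
    and "ce_d br f1 = 0" "ce_d br f2 = 0" "ce_d br f3 = 0"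
    and "ce_d br f4 = f1 \<and>\<^sub>f f2"
    and "ce_d br f5 = f1 \<and>\<^sub>f f3 + f1 \<and>\<^sub>f f4"
    and "ce_d br f6 = f2 \<and>\<^sub>f f4"
  shows "lie_isomorphic br h13"
  unfolding h13_def using assms by (intro lie_isomorphic_bracket_of) (auto simp: h_simps)

lemma lie_isomorphic_h14:
  assumes "coframe6 f1 f2 f3 f4 f5 f6"
    and "ce_d br f1 = 0" "ce_d br f2 = 0" "ce_d br f3 = 0"
    and "ce_d br f4 = f1 \<and>\<^sub>f f2"
    and "ce_d br f5 = f1 \<and>\<^sub>f f4"
    and "ce_d br f6 = f1 \<and>\<^sub>f f3 + f4 \<and>\<^sub>f f2"
  shows "lie_isomorphic br h14"
  unfolding h14_def using assms by (intro lie_isomorphic_bracket_of) (auto simp: h_simps)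

lemma lie_isomorphic_h15:
  assumes "coframe6 f1 f2 f3 f4 f5 f6"
    and "ce_d br f1 = 0" "ce_d br f2 = 0" "ce_d br f3 = 0"
    and "ce_d br f4 = f1 \<and>\<^sub>f f2"
    and "ce_d br f5 = f1 \<and>\<^sub>f f3 + f4 \<and>\<^sub>f f2"
    and "ce_d br f6 = f1 \<and>\<^sub>f f4 + f2 \<and>\<^sub>f f3"
  shows "lie_isomorphic br h15"
  unfolding h15_def using assms by (intro lie_isomorphic_bracket_of) (auto simp: h_simps)

text \<open>Here the traceless endomorphism is in companion form: it maps \<open>f1\<close> to \<open>f2\<close> and
  \<open>f2\<close> to \<open>\<Delta> f1\<close>.\<close>

definition normal_coframe ::
    "('g::real_vector \<Rightarrow> 'g \<Rightarrow> 'g) \<Rightarrow> real \<Rightarrow> real \<Rightarrow> ('g \<Rightarrow> real) \<Rightarrow> ('g \<Rightarrow> real) \<Rightarrow> ('g \<Rightarrow> real)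
      \<Rightarrow> ('g \<Rightarrow> real) \<Rightarrow> ('g \<Rightarrow> real) \<Rightarrow> ('g \<Rightarrow> real) \<Rightarrow> bool" where
  "normal_coframe br k \<Delta> f1 f2 f3 f4 f5 f6 \<longleftrightarrow> coframe6 f1 f2 f3 f4 f5 f6 \<and> k \<noteq> 0 \<and>
     ce_d br f1 = 0 \<and> ce_d br f2 = 0 \<and> ce_d br f3 = 0 \<and>
     (\<forall>X Y. ce_d br f4 X Y = k * (f1 \<and>\<^sub>f f2) X Y) \<and>
     (\<forall>X Y. ce_d br f5 X Y = (f1 \<and>\<^sub>f f4) X Y + (f2 \<and>\<^sub>f f3) X Y) \<and>
     (\<forall>X Y. ce_d br f6 X Y = (f2 \<and>\<^sub>f f4) X Y + \<Delta> * (f1 \<and>\<^sub>f f3) X Y)"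

lemma normal_coframe_bracket:
  fixes br :: "'g::real_vector \<Rightarrow> 'g \<Rightarrow> 'g"
  assumes "normal_coframe br k \<Delta> f1 f2 f3 f4 f5 f6"
  shows "f1 (br X Y) = 0" "f2 (br X Y) = 0" "f3 (br X Y) = 0"
    "f4 (br X Y) = - k * (f1 X * f2 Y - f1 Y * f2 X)"
    "f5 (br X Y) = - (f1 X * f4 Y - f1 Y * f4 X) - (f2 X * f3 Y - f2 Y * f3 X)"
    "f6 (br X Y) = - (f2 X * f4 Y - f2 Y * f4 X) - \<Delta> * (f1 X * f3 Y - f1 Y * f3 X)"
proof -
  have eval: "f (br X Y) = - ce_d br f X Y" for f :: "'g \<Rightarrow> real"
    by (simp add: ce_d_def)
  show "f1 (br X Y) = 0" "f2 (br X Y) = 0" "f3 (br X Y) = 0"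
    "f4 (br X Y) = - k * (f1 X * f2 Y - f1 Y * f2 X)"
    "f5 (br X Y) = - (f1 X * f4 Y - f1 Y * f4 X) - (f2 X * f3 Y - f2 Y * f3 X)"
    "f6 (br X Y) = - (f2 X * f4 Y - f2 Y * f4 X) - \<Delta> * (f1 X * f3 Y - f1 Y * f3 X)"
    unfolding eval using assms by (simp_all add: normal_coframe_def wedge_def)
qed

lemma normal_coframe_linear:
  assumes "normal_coframe br k \<Delta> f1 f2 f3 f4 f5 f6"
  shows "linear f1" "linear f2" "linear f3" "linear f4" "linear f5" "linear f6"
  using assms by (simp_all add: normal_coframe_def coframe6_def)

text \<open>The endomorphism is nilpotent with kernel spanned by \<open>f2\<close>. In
  \<open>h14\<close> the pencil gives the nilpotent map with kernel spanned by \<open>e 1\<close>,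
  so \<open>f2\<close> takes the place of \<open>e 1\<close>.\<close>

lemma normal_coframe_zero:
  fixes br :: "'g::real_vector \<Rightarrow> 'g \<Rightarrow> 'g"
  assumes n: "normal_coframe br k 0 f1 f2 f3 f4 f5 f6"
  shows "lie_isomorphic br h14"
proof (rule lie_isomorphic_h14)
  let ?E2 = "\<lambda>X. - k * f1 X" and ?E3 = "\<lambda>X. k * f3 X" and ?E6 = "\<lambda>X. k * f5 X"
  show "coframe6 f2 ?E2 ?E3 f4 f6 ?E6"
    using n by (auto simp: normal_coframe_def coframe6_def linear_iff algebra_simps)
  show "ce_d br f2 = 0" "ce_d br ?E2 = 0" "ce_d br ?E3 = 0"
    "ce_d br f4 = f2 \<and>\<^sub>f ?E2" "ce_d br f6 = f2 \<and>\<^sub>f f4" "ce_d br ?E6 = f2 \<and>\<^sub>f ?E3 + f4 \<and>\<^sub>f ?E2"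
    by (simp_all add: ce_d_def wedge_def fun_eq_iff normal_coframe_bracket[OF n] algebra_simps)
qed

text \<open>In the basis \<open>f1\<close>, \<open>f2 / r\<close> the endomorphism is
  \<open>r\<close> times a quarter turn, and \<open>h15\<close> is the case of the quarter turn
  itself. The other factors only rescale.\<close>

lemma normal_coframe_neg:
  fixes br :: "'g::real_vector \<Rightarrow> 'g \<Rightarrow> 'g"
  assumes n: "normal_coframe br k (- (r\<^sup>2)) f1 f2 f3 f4 f5 f6" and r: "r \<noteq> 0"
  shows "lie_isomorphic br h15"
proof (rule lie_isomorphic_h15)
  have k: "k \<noteq> 0"
    using n by (simp add: normal_coframe_def)
  let ?E2 = "\<lambda>X. f2 X / r" and ?E3 = "\<lambda>X. f3 X / k" and ?E4 = "\<lambda>X. f4 X / (k * r)"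
    and ?E5 = "\<lambda>X. - f6 X / (r\<^sup>2 * k)" and ?E6 = "\<lambda>X. f5 X / (k * r)"
  show "coframe6 f1 ?E2 ?E3 ?E4 ?E5 ?E6"
    using n r by (auto simp: normal_coframe_def coframe6_def linear_iff field_simps)
  show "ce_d br f1 = 0" "ce_d br ?E2 = 0" "ce_d br ?E3 = 0"
    "ce_d br ?E4 = f1 \<and>\<^sub>f ?E2" "ce_d br ?E5 = f1 \<and>\<^sub>f ?E3 + ?E4 \<and>\<^sub>f ?E2"
    "ce_d br ?E6 = f1 \<and>\<^sub>f ?E4 + ?E2 \<and>\<^sub>f ?E3"
    using k r by (simp_all add: ce_d_def wedge_def fun_eq_iff normal_coframe_bracket[OF n]
      field_simps power2_eq_square)
qed

text \<open>The eigenvectors \<open>f1 + f2 / r\<close> and \<open>f1 - f2 / r\<close> have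
  eigenvalues \<open>r\<close> and \<open>- r\<close>. Passing from \<open>f4\<close> to
  \<open>f4 - r f3\<close> shifts these to \<open>2 r\<close> and 0, and rescaling gives the
  eigenvalues 1 and 0 of \<open>h13\<close>.\<close>

lemma normal_coframe_pos:
  fixes br :: "'g::real_vector \<Rightarrow> 'g \<Rightarrow> 'g"
  assumes n: "normal_coframe br k (r\<^sup>2) f1 f2 f3 f4 f5 f6" and r: "r \<noteq> 0"
  shows "lie_isomorphic br h13"
proof (rule lie_isomorphic_h13)
  have k: "k \<noteq> 0"
    using n by (simp add: normal_coframe_def)
  \<comment> \<open>This factor makes the differential of \<open>?E4\<close> equal to the wedge of
    \<open>?E1\<close> and \<open>?E2\<close>, which is \<open>- 2 / r\<close> times that of
    \<open>f1\<close> and \<open>f2\<close>.\<close>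
  let ?z = "- 2 / (r * k)"
  let ?E1 = "\<lambda>X. f1 X + f2 X / r" and ?E2 = "\<lambda>X. f1 X - f2 X / r" 
    and ?E3 = "\<lambda>X. ?z * 2 * r * f3 X" and ?E4 = "\<lambda>X. ?z * (f4 X - r * f3 X)"
    and ?E5 = "\<lambda>X. ?z * (f5 X + f6 X / r)" and ?E6 = "\<lambda>X. ?z * (f5 X - f6 X / r)"
  have "a = 0 \<and> b = 0" if "a + b / r = 0" "a - b / r = 0" for a b :: real
  proof -
    have "2 * a = 0" "2 * (b / r) = 0"
      using that by linarith+
    then show ?thesis
      using r by simp
  qed
  then have "X = 0" if "?E1 X = 0" "?E2 X = 0" "?E3 X = 0" "?E4 X = 0" "?E5 X = 0" "?E6 X = 0" for X
    using that n r k by (simp add: normal_coframe_def coframe6_def)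
  moreover have "linear ?E1" "linear ?E2" "linear ?E3" "linear ?E4" "linear ?E5" "linear ?E6"
    using normal_coframe_linear[OF n] by (simp_all add: linear_iff algebra_simps add_divide_distrib diff_divide_distrib)
  ultimately show "coframe6 ?E1 ?E2 ?E3 ?E4 ?E5 ?E6"
    using n unfolding normal_coframe_def coframe6_def by blast
  show "ce_d br ?E1 = 0" "ce_d br ?E2 = 0" "ce_d br ?E3 = 0"
    "ce_d br ?E4 = ?E1 \<and>\<^sub>f ?E2" "ce_d br ?E5 = ?E1 \<and>\<^sub>f ?E3 + ?E1 \<and>\<^sub>f ?E4"
    "ce_d br ?E6 = ?E2 \<and>\<^sub>f ?E4"
    using k r by (simp_all add: ce_d_def wedge_def fun_eq_iff normal_coframe_bracket[OF n]
      field_simps power2_eq_square)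
qed

section \<open>An invariant separating the three algebras\<close>

definition centralizes_derived :: "('g::real_vector \<Rightarrow> 'g \<Rightarrow> 'g) \<Rightarrow> 'g \<Rightarrow> bool" where
  "centralizes_derived br Y \<longleftrightarrow> (\<forall>U V. br Y (br U V) = 0)"

definition central :: "('g::real_vector \<Rightarrow> 'g \<Rightarrow> 'g) \<Rightarrow> 'g \<Rightarrow> bool" where
  "central br Y \<longleftrightarrow> (\<forall>U. br Y U = 0)"

definition singular_directions :: "('g::real_vector \<Rightarrow> 'g \<Rightarrow> 'g) \<Rightarrow> 'g set" where
  "singular_directions br = {X. \<exists>Y. centralizes_derived br Y \<and> \<not> central br Y \<and> br X Y = 0}"

text \<open>This tells a subspace from a union of two hyperplanes, the shape of the singular
  directions of \<open>h13\<close>.\<close>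

definition sum_closed :: "'g::plus set \<Rightarrow> bool" where
  "sum_closed S \<longleftrightarrow> (\<forall>X\<in>S. \<forall>Y\<in>S. X + Y \<in> S)"

lemma lie_isomorphic_invariants:
  assumes "lie_isomorphic br br'"
  shows "sum_closed (singular_directions br) \<longleftrightarrow> sum_closed (singular_directions br')" (is ?closed)
    and "singular_directions br \<subseteq> Collect (centralizes_derived br) \<longleftrightarrow>
         singular_directions br' \<subseteq> Collect (centralizes_derived br')" (is ?sub)
proof -
  obtain f where f: "linear f" "bij f" and hom: "\<And>X Y. f (br X Y) = br' (f X) (f Y)"
    using assms unfolding lie_isomorphic_def by blast
  have zero: "f X = 0 \<longleftrightarrow> X = 0" for X
    using f linear_0 by (metis bij_is_inj injD)
  have all: "(\<forall>X. P (f X)) \<longleftrightarrow> (\<forall>X. P X)" for P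
    using f by (metis bij_pointE)
  have ex: "(\<exists>X. P (f X)) \<longleftrightarrow> (\<exists>X. P X)" for P
    using f by (metis bij_pointE)
  have cd: "centralizes_derived br Y \<longleftrightarrow> centralizes_derived br' (f Y)" for Y
    \<comment> \<open>Writing \<open>Z = 0\<close> as \<open>f Z = 0\<close> pushes \<open>f\<close>
      down to the arguments of the bracket; bijectivity then absorbs it into the
      quantifiers.\<close>
    unfolding centralizes_derived_def zero[symmetric] hom
    by (simp add: all[of "\<lambda>V. br' (f Y) (br' (f U) V) = 0" for U]
        all[of "\<lambda>U. \<forall>V. br' (f Y) (br' U V) = 0"])
  have ce: "central br Y \<longleftrightarrow> central br' (f Y)" for Y
    unfolding central_def zero[symmetric] hom by (simp add: all[of "\<lambda>U. br' (f Y) U = 0"])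
  have sd: "X \<in> singular_directions br \<longleftrightarrow> f X \<in> singular_directions br'" for X
    unfolding singular_directions_def mem_Collect_eq zero[symmetric, of "br _ _"] hom cd ce
    by (rule ex)
  have add: "f (X + Y) = f X + f Y" for X Y
    using f(1) by (rule linear_add)
  show ?closed
    unfolding sum_closed_def Ball_def sd add
    by (metis (no_types) bij_pointE f(2))
  show ?sub
    unfolding subset_iff sd mem_Collect_eq cd by (rule all)
qed

section \<open>Singular directions of the three algebras\<close>

lemma h13_nth:
  "h13 X Y $ 1 = 0" "h13 X Y $ 2 = 0" "h13 X Y $ 3 = 0"
  "h13 X Y $ 4 = X $ 2 * Y $ 1 - X $ 1 * Y $ 2"
  "h13 X Y $ 5 = X $ 3 * Y $ 1 - X $ 1 * Y $ 3 + X $ 4 * Y $ 1 - X $ 1 * Y $ 4"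
  "h13 X Y $ 6 = X $ 4 * Y $ 2 - X $ 2 * Y $ 4"
  by (simp_all add: h13_def h_simps)

lemma h14_nth:
  "h14 X Y $ 1 = 0" "h14 X Y $ 2 = 0" "h14 X Y $ 3 = 0"
  "h14 X Y $ 4 = X $ 2 * Y $ 1 - X $ 1 * Y $ 2"
  "h14 X Y $ 5 = X $ 4 * Y $ 1 - X $ 1 * Y $ 4"
  "h14 X Y $ 6 = X $ 3 * Y $ 1 - X $ 1 * Y $ 3 + X $ 2 * Y $ 4 - X $ 4 * Y $ 2"
  by (simp_all add: h14_def h_simps)

lemma h15_nth:
  "h15 X Y $ 1 = 0" "h15 X Y $ 2 = 0" "h15 X Y $ 3 = 0"
  "h15 X Y $ 4 = X $ 2 * Y $ 1 - X $ 1 * Y $ 2"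
  "h15 X Y $ 5 = X $ 3 * Y $ 1 - X $ 1 * Y $ 3 + X $ 2 * Y $ 4 - X $ 4 * Y $ 2"
  "h15 X Y $ 6 = X $ 4 * Y $ 1 - X $ 1 * Y $ 4 + X $ 3 * Y $ 2 - X $ 2 * Y $ 3"
  by (simp_all add: h15_def h_simps)

text \<open>The derived algebra is spanned by the basis vectors 4, 5, 6, of which the last two are
  central. Up to sign the fourth is the bracket of the first two, so this single bracket already
  tests both coordinates of \<open>Y\<close>; the same holds in \<open>h14\<close> and
  \<open>h15\<close>.\<close>

lemma centralizes_derived_h13: "centralizes_derived h13 Y \<longleftrightarrow> Y $ 1 = 0 \<and> Y $ 2 = 0"
proof
  assume "centralizes_derived h13 Y"
  then have "h13 Y (h13 (axis 1 1) (axis 2 1)) = 0"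
    unfolding centralizes_derived_def by blast
  then show "Y $ 1 = 0 \<and> Y $ 2 = 0"
    by (simp add: vec_eq_iff forall_6 h13_nth axis_def)
qed (simp add: centralizes_derived_def vec_eq_iff forall_6 h13_nth)

lemma central_h13:
  assumes "Y $ 1 = 0" "Y $ 2 = 0"
  shows "central h13 Y \<longleftrightarrow> Y $ 3 = 0 \<and> Y $ 4 = 0"
proof
  assume "central h13 Y"
  then have "h13 Y (axis 1 1) = 0" "h13 Y (axis 2 1) = 0"
    unfolding central_def by blast+
  then show "Y $ 3 = 0 \<and> Y $ 4 = 0"
    by (simp add: vec_eq_iff forall_6 h13_nth axis_def)
qed (use assms in \<open>simp add: central_def vec_eq_iff forall_6 h13_nth\<close>)

lemma centralizes_derived_h14: "centralizes_derived h14 Y \<longleftrightarrow> Y $ 1 = 0 \<and> Y $ 2 = 0"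
proof
  assume "centralizes_derived h14 Y"
  then have "h14 Y (h14 (axis 1 1) (axis 2 1)) = 0"
    unfolding centralizes_derived_def by blast
  then show "Y $ 1 = 0 \<and> Y $ 2 = 0"
    by (simp add: vec_eq_iff forall_6 h14_nth axis_def)
qed (simp add: centralizes_derived_def vec_eq_iff forall_6 h14_nth)

lemma central_h14:
  assumes "Y $ 1 = 0" "Y $ 2 = 0"
  shows "central h14 Y \<longleftrightarrow> Y $ 3 = 0 \<and> Y $ 4 = 0"
proof
  assume "central h14 Y"
  then have "h14 Y (axis 1 1) = 0" "h14 Y (axis 2 1) = 0"
    unfolding central_def by blast+
  then show "Y $ 3 = 0 \<and> Y $ 4 = 0"
    by (simp add: vec_eq_iff forall_6 h14_nth axis_def)
qed (use assms in \<open>simp add: central_def vec_eq_iff forall_6 h14_nth\<close>)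

lemma centralizes_derived_h15: "centralizes_derived h15 Y \<longleftrightarrow> Y $ 1 = 0 \<and> Y $ 2 = 0"
proof
  assume "centralizes_derived h15 Y"
  then have "h15 Y (h15 (axis 1 1) (axis 2 1)) = 0"
    unfolding centralizes_derived_def by blast
  then show "Y $ 1 = 0 \<and> Y $ 2 = 0"
    by (simp add: vec_eq_iff forall_6 h15_nth axis_def)
qed (simp add: centralizes_derived_def vec_eq_iff forall_6 h15_nth)

lemma central_h15:
  assumes "Y $ 1 = 0" "Y $ 2 = 0"
  shows "central h15 Y \<longleftrightarrow> Y $ 3 = 0 \<and> Y $ 4 = 0"
proof
  assume "central h15 Y"
  then have "h15 Y (axis 1 1) = 0" "h15 Y (axis 2 1) = 0"
    unfolding central_def by blast+
  then show "Y $ 3 = 0 \<and> Y $ 4 = 0"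
    by (simp add: vec_eq_iff forall_6 h15_nth axis_def)
qed (use assms in \<open>simp add: central_def vec_eq_iff forall_6 h15_nth\<close>)

text \<open>Modulo the center, an element of the centralizer is the pair of its coordinates 3 and 4.
  For each algebra \<open>P\<close> is a homogeneous linear system in this pair, with a nonzero
  solution exactly when its determinant vanishes.\<close>

lemma singular_directions_iff:
  assumes "\<And>Y. centralizes_derived h Y \<longleftrightarrow> Y $ 1 = 0 \<and> Y $ 2 = 0"
    and "\<And>Y. Y $ 1 = 0 \<Longrightarrow> Y $ 2 = 0 \<Longrightarrow> central h Y \<longleftrightarrow> Y $ 3 = 0 \<and> Y $ 4 = 0"
    and "\<And>Y. Y $ 1 = 0 \<Longrightarrow> Y $ 2 = 0 \<Longrightarrow> h X Y = 0 \<longleftrightarrow> P (Y $ 3) (Y $ 4)"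
  shows "X \<in> singular_directions (h :: real^6 \<Rightarrow> _) \<longleftrightarrow> (\<exists>a b. (a \<noteq> 0 \<or> b \<noteq> 0) \<and> P a b)"
proof
  assume "X \<in> singular_directions h"
  then show "\<exists>a b. (a \<noteq> 0 \<or> b \<noteq> 0) \<and> P a b"
    using assms unfolding singular_directions_def by blast
next
  assume "\<exists>a b. (a \<noteq> 0 \<or> b \<noteq> 0) \<and> P a b"
  then obtain a b where ab: "a \<noteq> 0 \<or> b \<noteq> 0" "P a b"
    by blast
  define Y :: "real^6" where "Y = axis 3 a + axis 4 b"
  have "Y $ 1 = 0" "Y $ 2 = 0" "Y $ 3 = a" "Y $ 4 = b"
    by (simp_all add: Y_def axis_def)
  with ab assms show "X \<in> singular_directions h"
    unfolding singular_directions_def by blast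
qed

lemma singular_directions_h13: "X \<in> singular_directions h13 \<longleftrightarrow> X $ 1 * X $ 2 = 0"
proof -
  have "X \<in> singular_directions h13 \<longleftrightarrow>
      (\<exists>a b. (a \<noteq> 0 \<or> b \<noteq> 0) \<and> X $ 1 * (a + b) = 0 \<and> X $ 2 * b = 0)"
    by (rule singular_directions_iff[OF centralizes_derived_h13 central_h13])
      (auto simp: vec_eq_iff forall_6 h13_nth algebra_simps)
  \<comment> \<open>If \<open>X $ 1 = 0\<close>, take \<open>b = 0\<close>; if
    \<open>X $ 2 = 0\<close>, take \<open>b = - a\<close>.\<close>
  also have "\<dots> \<longleftrightarrow> X $ 1 * X $ 2 = 0"
    by (auto intro: exI[of _ 1] exI[of _ "- 1"])
  finally show ?thesis .
qed

lemma singular_directions_h14: "X \<in> singular_directions h14 \<longleftrightarrow> X $ 1 = 0"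
proof -
  have "X \<in> singular_directions h14 \<longleftrightarrow>
      (\<exists>a b. (a \<noteq> 0 \<or> b \<noteq> 0) \<and> X $ 1 * b = 0 \<and> X $ 1 * a = X $ 2 * b)"
    by (rule singular_directions_iff[OF centralizes_derived_h14 central_h14])
      (auto simp: vec_eq_iff forall_6 h14_nth algebra_simps)
  also have "\<dots> \<longleftrightarrow> X $ 1 = 0"
    by (auto intro: exI[of _ 1])
  finally show ?thesis .
qed

lemma singular_directions_h15: "X \<in> singular_directions h15 \<longleftrightarrow> X $ 1 = 0 \<and> X $ 2 = 0"
proof -
  have "X \<in> singular_directions h15 \<longleftrightarrow>
      (\<exists>a b. (a \<noteq> 0 \<or> b \<noteq> 0) \<and> X $ 1 * a = X $ 2 * b \<and> X $ 1 * b + X $ 2 * a = 0)"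
    by (rule singular_directions_iff[OF centralizes_derived_h15 central_h15])
      (auto simp: vec_eq_iff forall_6 h15_nth algebra_simps)
  also have "\<dots> \<longleftrightarrow> X $ 1 = 0 \<and> X $ 2 = 0"
  proof
    assume "\<exists>a b. (a \<noteq> 0 \<or> b \<noteq> 0) \<and> X $ 1 * a = X $ 2 * b \<and> X $ 1 * b + X $ 2 * a = 0"
    then obtain a b where ab: "a \<noteq> 0 \<or> b \<noteq> 0" "X $ 1 * a = X $ 2 * b" "X $ 1 * b + X $ 2 * a = 0"
      by blast
    \<comment> \<open>Read as a linear system in \<open>X $ 1\<close> and \<open>X $ 2\<close>, the
      two equations have determinant a^2 + b^2.\<close>
    have "X $ 1 * (a\<^sup>2 + b\<^sup>2) = 0" "X $ 2 * (a\<^sup>2 + b\<^sup>2) = 0"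
      using ab(2,3) by algebra+
    with ab(1) show "X $ 1 = 0 \<and> X $ 2 = 0"
      by (auto simp: sum_power2_eq_zero_iff)
  qed (auto intro: exI[of _ 1])
  finally show ?thesis .
qed

lemma sum_closed_singular_directions_h:
  "\<not> sum_closed (singular_directions h13)"
  "sum_closed (singular_directions h14)"
  "sum_closed (singular_directions h15)"
proof -
  have "axis 1 1 \<in> singular_directions h13" "axis 2 1 \<in> singular_directions h13"
    "axis 1 1 + axis 2 1 \<notin> singular_directions h13"
    by (simp_all add: singular_directions_h13 axis_def)
  then show "\<not> sum_closed (singular_directions h13)"
    unfolding sum_closed_def by blast
qed (auto simp: sum_closed_def singular_directions_h14 singular_directions_h15)

lemma singular_directions_centralizes_derived_h:
  "\<not> singular_directions h14 \<subseteq> Collect (centralizes_derived h14)"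
  "singular_directions h15 \<subseteq> Collect (centralizes_derived h15)"
proof -
  have "axis 2 1 \<in> singular_directions h14" "\<not> centralizes_derived h14 (axis 2 1)"
    by (simp_all add: singular_directions_h14 centralizes_derived_h14 axis_def)
  then show "\<not> singular_directions h14 \<subseteq> Collect (centralizes_derived h14)"
    by blast
qed (auto simp: singular_directions_h15 centralizes_derived_h15)

text \<open>Closure under sums separates \<open>h13\<close> from the other two, and inclusion in the
  centralizer separates \<open>h14\<close> from \<open>h15\<close>.\<close>

lemma lie_isomorphic_exclusive:
  "\<not> (lie_isomorphic br h13 \<and> lie_isomorphic br h14)"
  "\<not> (lie_isomorphic br h13 \<and> lie_isomorphic br h15)"
  "\<not> (lie_isomorphic br h14 \<and> lie_isomorphic br h15)"
  using lie_isomorphic_invariants[of br h13] lie_isomorphic_invariants[of br h14]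
    lie_isomorphic_invariants[of br h15] sum_closed_singular_directions_h
    singular_directions_centralizes_derived_h by metis+

section \<open>The normal coframe of the complex structure\<close>

lemma forms10_separate_points:
  assumes J: "linear J" "\<And>X. J (J X) = - X" and X: "\<And>\<alpha>. \<alpha> \<in> forms10 J \<Longrightarrow> \<alpha> X = 0"
  shows "X = 0"
proof (rule ccontr)
  assume "X \<noteq> 0"
  then have "independent {X}"
    by (simp add: dependent_single)
  then obtain g where g: "linear g" "g X = (1 :: real)"
    using linear_independent_extend[of "{X}" "\<lambda>_. 1"] by auto
  \<comment> \<open>This is the (1,0)-form with real part \<open>g\<close>.\<close>
  define \<alpha> where "\<alpha> = (\<lambda>Y. complex_of_real (g Y) - \<i> * complex_of_real (g (J Y)))"
  have "\<alpha> \<in> forms10 J"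
    using J g(1)
    by (auto simp: \<alpha>_def forms10_def complexified_dual_def dual_action_def cscale_def
        linear_iff linear_neg fun_eq_iff algebra_simps scaleR_conv_of_real)
  with X have "\<alpha> X = 0" .
  with g(2) show False
    by (simp add: \<alpha>_def complex_eq_iff)
qed

lemma basis10_linear:
  assumes "basis10 J w1 w2 w3"
  shows "linear w1" "linear w2" "linear w3"
proof -
  have "{w1, w2, w3} \<subseteq> forms10 J"
    using assms cfun.span_superset unfolding basis10_def by metis
  then show "linear w1" "linear w2" "linear w3"
    by (auto simp: forms10_def complexified_dual_def)
qed

lemma basis10_separate_points:
  assumes "complex_structure br J" "basis10 J w1 w2 w3" and "w1 X = 0" "w2 X = 0" "w3 X = 0"
  shows "X = 0"
proof (rule forms10_separate_points)
  show "linear J" "J (J Y) = - Y" for Y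
    using assms(1) by (auto simp: complex_structure_def)
  fix \<alpha> assume "\<alpha> \<in> forms10 J"
  then have "\<alpha> \<in> cfun.span {w1, w2, w3}"
    using assms(2) by (simp add: basis10_def)
  then show "\<alpha> X = 0"
    by (induction rule: cfun.span_induct_alt) (use assms(3-) in \<open>auto simp: cscale_def\<close>)
qed

text \<open>Under the real part, the term with factor \<open>c\<close> may be conjugated, so that
  \<open>w1\<close> is the left factor everywhere. Splitting \<open>w2\<close> into real and
  imaginary parts then gives the pencil.\<close>

lemma d_Re_w3:
  fixes B l :: complex and c :: real
  assumes "ce_d br w3 = (\<lambda>X Y. (w1 \<and>\<^sub>f w2) X Y + B * (w1 \<and>\<^sub>f conj_form w2) X Y
            + complex_of_real c * (w2 \<and>\<^sub>f conj_form w1) X Y)"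
  shows "Re (l * ce_d br w3 X Y) =
    ((\<lambda>X. Re ((l * (1 + B) - c * cnj l) * w1 X)) \<and>\<^sub>f (\<lambda>X. Re (w2 X))) X Y +
    ((\<lambda>X. Re (\<i> * (l * (1 - B) + c * cnj l) * w1 X)) \<and>\<^sub>f (\<lambda>X. Im (w2 X))) X Y"
  unfolding assms wedge_def conj_form_def by (simp add: algebra_simps)

text \<open>The map sending the coefficient \<open>u\<close> of \<open>Im w2\<close> to that of \<open>Re w2\<close> has traceless part
  \<open>u \<mapsto> - \<i> (m u + 2 c cnj u) / D\<close> with \<open>m = 1 - |B|\<^sup>2 + c\<^sup>2\<close>. It interchanges the real and the
  imaginary axis, so it is enough to treat \<open>u\<close> with \<open>cnj u = u\<close> or \<open>cnj u = - u\<close>.\<close>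

lemma d_Re_w3_coefficients:
  fixes B u :: complex and c s D :: real
  assumes D: "D = (cmod (1 - B))\<^sup>2 - c\<^sup>2" "D \<noteq> 0" and u: "cnj u = s * u" and s: "s\<^sup>2 = 1"
    and l: "l = - \<i> * u * (1 - cnj B + c * s) / D"
  shows "\<i> * (l * (1 - B) + c * cnj l) = u"
    and "l * (1 + B) - c * cnj l =
      - \<i> * u * ((1 - (cmod B)\<^sup>2 + c\<^sup>2 + 2 * c * s) / D) + (2 * Im B / D) * u"
proof -
  have D': "complex_of_real D = (1 - B) * (1 - cnj B) - (complex_of_real c)\<^sup>2"
    unfolding D of_real_diff complex_norm_square by simp
  have s': "(complex_of_real s)\<^sup>2 = 1"
    using s by (metis of_real_1 of_real_power)
  \<comment> \<open>The formula for \<open>l\<close> is Cramer's rule for the equation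
    \<open>\<i> * (l * (1 - B) + c * cnj l) = u\<close> and its conjugate, a linear system in
    \<open>l\<close> and \<open>cnj l\<close> with determinant \<open>D\<close>.\<close>
  have Dl: "D * l = - \<i> * u * (1 - cnj B + c * s)"
    using D(2) by (simp add: l)
  have Dcl: "D * cnj l = \<i> * (s * u) * (1 - B + c * s)"
    using D(2) by (simp add: l u[symmetric])
  have "D * (\<i> * (l * (1 - B) + c * cnj l)) = \<i> * ((D * l) * (1 - B) + c * (D * cnj l))"
    by (simp add: algebra_simps)
  also have "\<dots> = u * ((1 - cnj B + c * s) * (1 - B) - c * s * (1 - B + c * s))"
    unfolding Dl Dcl by (simp add: algebra_simps)
  also have "\<dots> = D * u"
    unfolding D' of_real_mult using s' by algebra
  finally show "\<i> * (l * (1 - B) + c * cnj l) = u"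
    using D(2) by simp
  have b': "complex_of_real ((cmod B)\<^sup>2) = B * cnj B"
    by (rule complex_norm_square)
  have im': "complex_of_real (2 * Im B) = - \<i> * (B - cnj B)"
    by (simp add: complex_eq_iff)
  have "D * (l * (1 + B) - c * cnj l) = (D * l) * (1 + B) - c * (D * cnj l)"
    by (simp add: algebra_simps)
  also have "\<dots> = - \<i> * u * ((1 - cnj B + c * s) * (1 + B) + c * s * (1 - B + c * s))"
    unfolding Dl Dcl by (simp add: algebra_simps)
  also have "\<dots> = - \<i> * u * (1 - B * cnj B + (complex_of_real c)\<^sup>2 + 2 * c * s) +
      (- \<i> * (B - cnj B)) * u"
    unfolding of_real_mult of_real_numeral using s' by algebra
  also have "\<dots> = D * (- \<i> * u * ((1 - (cmod B)\<^sup>2 + c\<^sup>2 + 2 * c * s) / D) + (2 * Im B / D) * u)"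
    unfolding b'[symmetric] im'[symmetric] distrib_left using D(2) by (simp add: field_simps)
  finally show "l * (1 + B) - c * cnj l =
      - \<i> * u * ((1 - (cmod B)\<^sup>2 + c\<^sup>2 + 2 * c * s) / D) + (2 * Im B / D) * u"
    using D(2) by simp
qed

text \<open>As real linear equations in \<open>Re w\<close> and \<open>Im w\<close>, the two
  conditions have determinant \<open>t\<^sup>2 - (cmod a)\<^sup>2\<close>. This yields the vanishing
  of \<open>w3\<close> from that of \<open>f5\<close> and \<open>f6\<close>.\<close>

lemma Im_Re_eq_0_imp_eq_0:
  assumes "Im ((a + of_real t) * w) = 0" "Re ((a - of_real t) * w) = 0" and "(cmod a)\<^sup>2 \<noteq> t\<^sup>2"
  shows "w = 0"
proof -
  have "((cmod a)\<^sup>2 - t\<^sup>2) * Re w = 0" "((cmod a)\<^sup>2 - t\<^sup>2) * Im w = 0"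
    using assms(1,2) unfolding cmod_power2 by (simp_all, algebra+)
  with assms(3) show ?thesis
    by (simp add: complex_eq_iff)
qed

text \<open>Companion form comes from a vector \<open>u\<close> not killed by the traceless
  endomorphism and its image \<open>v\<close>. These give \<open>f1\<close>, \<open>f2\<close>, and
  the parameters \<open>l\<close>, \<open>l'\<close> whose coefficients of \<open>Im w2\<close> are
  \<open>u\<close>, \<open>v\<close> give \<open>f5\<close>, \<open>f6\<close>.\<close>

lemma exists_normal_coframe:
  fixes br :: "'g::real_vector \<Rightarrow> 'g \<Rightarrow> 'g" and B :: complex and c :: real
  assumes dim: "dim (UNIV :: 'g set) = 6"
    and J: "complex_structure br J" and w: "basis10 J w1 w2 w3"
    and dw1: "ce_d br w1 = (\<lambda>X Y. 0)"
    and dw2: "ce_d br w2 = w1 \<and>\<^sub>f conj_form w1"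
    and dw3: "ce_d br w3 = (\<lambda>X Y. (w1 \<and>\<^sub>f w2) X Y + B * (w1 \<and>\<^sub>f conj_form w2) X Y
            + complex_of_real c * (w2 \<and>\<^sub>f conj_form w1) X Y)"
    and c: "c \<ge> 0" "c \<noteq> cmod (B - 1)" "(c, cmod B) \<noteq> (0, 1)"
  obtains D k f1 f2 f3 f4 f5 f6 where "D \<noteq> 0"
    "normal_coframe br k
       (- ((c ^ 4 - 2 * ((cmod B)\<^sup>2 + 1) * c\<^sup>2 + ((cmod B)\<^sup>2 - 1)\<^sup>2) / D\<^sup>2)) f1 f2 f3 f4 f5 f6"
proof -
  define D where "D = (cmod (1 - B))\<^sup>2 - c\<^sup>2"
  have D: "D \<noteq> 0"
    using c by (auto simp: D_def norm_minus_commute dest: power2_eq_imp_eq)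
  define m where "m = 1 - (cmod B)\<^sup>2 + c\<^sup>2"
  \<comment> \<open>Up to the factor \<open>- \<i> / D\<close>, the traceless endomorphism
    multiplies the real axis by \<open>m + 2 * c\<close> and the imaginary axis by
    \<open>m - 2 * c\<close>.\<close>
  have "m + 2 * c \<noteq> 0 \<or> m - 2 * c \<noteq> 0"
  proof (rule ccontr)
    assume "\<not> ?thesis"
    then have "c = 0" "(cmod B)\<^sup>2 = 1"
      by (auto simp: m_def)
    then show False
      using c(3) by (simp add: power2_eq_1_iff) (metis norm_ge_zero not_one_le_zero neg_0_le_iff_le)
  qed
  then obtain u :: complex and s :: real
    where us: "u = 1 \<and> s = 1 \<or> u = \<i> \<and> s = -1" and n0: "m + 2 * c * s \<noteq> 0"
    by fastforce
  define n where "n = m + 2 * c * s"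
  have s: "s\<^sup>2 = 1" "(- s)\<^sup>2 = 1" and u: "cnj u = s * u"
    using us by auto
  define v where "v = - \<i> * u * (n / D)"
  have v: "cnj v = (- s) * v"
    by (simp add: v_def u)
  \<comment> \<open>The scalar part of the endomorphism is \<open>- t\<close>; it is absorbed by
    subtracting \<open>t * Re (w2 X)\<close> in \<open>f4\<close>.\<close>
  define t where "t = - 2 * Im B / D"
  define \<Delta> where "\<Delta> = - ((c ^ 4 - 2 * ((cmod B)\<^sup>2 + 1) * c\<^sup>2 + ((cmod B)\<^sup>2 - 1)\<^sup>2) / D\<^sup>2)"
  define l where "l = - \<i> * u * (1 - cnj B + c * s) / D"
  define l' where "l' = - \<i> * v * (1 - cnj B + complex_of_real (c * (- s))) / D"
  note cu = d_Re_w3_coefficients[OF D_def D u s(1) l_def]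
  note cv = d_Re_w3_coefficients[OF D_def D v s(2) l'_def]
  have l1: "\<i> * (l * (1 - B) + c * cnj l) = u" "l * (1 + B) - c * cnj l = v - t * u"
    unfolding cu by (simp_all add: v_def t_def n_def m_def)
  \<comment> \<open>The vector \<open>v\<close> lies on the other axis, where the factor is
    \<open>m - 2 * c * s\<close>. Hence the square of the endomorphism is multiplication by
    \<open>\<Delta>\<close>.\<close>
  have "n * (m - 2 * c * s) = m\<^sup>2 - 4 * c\<^sup>2 * s\<^sup>2"
    by (simp add: n_def power2_eq_square algebra_simps)
  also have "\<dots> = c ^ 4 - 2 * ((cmod B)\<^sup>2 + 1) * c\<^sup>2 + ((cmod B)\<^sup>2 - 1)\<^sup>2"
    unfolding s m_def by algebra
  finally have "n * (m - 2 * c * s) / D\<^sup>2 = - \<Delta>"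
    by (simp add: \<Delta>_def)
  moreover have "- \<i> * v * ((m - 2 * c * s) / D) = - complex_of_real (n * (m - 2 * c * s) / D\<^sup>2) * u"
    using D by (simp add: v_def power2_eq_square field_simps)
  ultimately have "- \<i> * v * ((m - 2 * c * s) / D) = \<Delta> * u"
    by simp
  then have l2: "\<i> * (l' * (1 - B) + c * cnj l') = v" "l' * (1 + B) - c * cnj l' = \<Delta> * u - t * v"
    unfolding cv by (simp_all add: t_def m_def)
  define f1 where "f1 = (\<lambda>X. Re (u * w1 X))"
  define f2 where "f2 = (\<lambda>X. Re (v * w1 X))"
  define f3 where "f3 = (\<lambda>X. Re (w2 X))"
  define f4 where "f4 = (\<lambda>X. Im (w2 X) - t * Re (w2 X))"
  define f5 where "f5 = (\<lambda>X. Re (l * w3 X))"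
  define f6 where "f6 = (\<lambda>X. Re (l' * w3 X))"
  note f = f1_def f2_def f3_def f4_def f5_def f6_def
  have dw2': "Re (w2 (br X Y)) = 0 \<and>
      - Im (w2 (br X Y)) = 2 * (Re (w1 Y) * Im (w1 X) - Re (w1 X) * Im (w1 Y))" for X Y
    using fun_cong[OF fun_cong[OF dw2], of X Y]
    by (simp add: ce_d_def wedge_def conj_form_def complex_eq_iff algebra_simps)
  have dRe: "Re (w2 (br X Y)) = 0" for X Y
    using dw2' by blast
  have dIm: "Im (w2 (br X Y)) = 2 * (Re (w1 X) * Im (w1 Y) - Re (w1 Y) * Im (w1 X))" for X Y
    using dw2'[of X Y] by argo
  have "X = 0" if X: "f1 X = 0" "f2 X = 0" "f3 X = 0" "f4 X = 0" "f5 X = 0" "f6 X = 0" for X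
  proof (rule basis10_separate_points[OF J w])
    show "w1 X = 0"
      using X(1,2) us D n0 by (auto simp: f v_def n_def complex_eq_iff)
    show "w2 X = 0"
      using X(3,4) by (auto simp: f complex_eq_iff)
    \<comment> \<open>Clearing real denominators turns \<open>f5 X = 0\<close> and
      \<open>f6 X = 0\<close> into an imaginary and a real part, since \<open>v\<close> contributes
      a further factor \<open>- \<i>\<close>.\<close>
    have "of_real D * (l * w3 X) = - \<i> * ((1 - cnj B + of_real (c * s)) * (u * w3 X))"
      using D by (simp add: l_def)
    from arg_cong[OF this, of Re] have "Im ((1 - cnj B + of_real (c * s)) * (u * w3 X)) = 0"
      using X(5) by (simp add: f del: complex_cnj_one)
    moreover have "of_real (D * D / n) * (l' * w3 X) =
        - ((1 - cnj B - of_real (c * s)) * (u * w3 X))"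
      using D n0 by (simp add: l'_def v_def flip: n_def)
    from arg_cong[OF this, of Re] have "Re ((1 - cnj B - of_real (c * s)) * (u * w3 X)) = 0"
      using X(6) by (simp add: f)
    moreover have "(cmod (1 - cnj B))\<^sup>2 \<noteq> (c * s)\<^sup>2"
      using D s by (simp add: D_def power_mult_distrib cmod_power2)
    ultimately have "u * w3 X = 0"
      by (rule Im_Re_eq_0_imp_eq_0)
    then show "w3 X = 0"
      using us by auto
  qed
  moreover have "linear f1" "linear f2" "linear f3" "linear f4" "linear f5" "linear f6"
    using basis10_linear[OF w] unfolding f linear_iff by (simp_all add: algebra_simps)
  ultimately have "coframe6 f1 f2 f3 f4 f5 f6"
    using dim by (simp add: coframe6_def)
  moreover have "ce_d br f1 = 0" "ce_d br f2 = 0"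
    using dw1 by (simp_all add: f ce_d_def fun_eq_iff)
  moreover have "ce_d br f3 = 0"
    by (simp add: f ce_d_def fun_eq_iff dRe)
  moreover have "ce_d br f4 X Y = (- 2 * D / n) * (f1 \<and>\<^sub>f f2) X Y" for X Y
  proof -
    have "(f1 \<and>\<^sub>f f2) X Y = (n / D) * (Re (w1 X) * Im (w1 Y) - Re (w1 Y) * Im (w1 X))"
      using us by (auto simp: f v_def wedge_def algebra_simps)
    then show ?thesis
      using D n0 by (simp add: f ce_d_def dRe dIm flip: n_def)
  qed
  moreover have "ce_d br f5 X Y = (f1 \<and>\<^sub>f f4) X Y + (f2 \<and>\<^sub>f f3) X Y" for X Y
    using d_Re_w3[OF dw3, of l X Y] unfolding l1
    by (simp add: f ce_d_def wedge_def algebra_simps)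
  moreover have "ce_d br f6 X Y = (f2 \<and>\<^sub>f f4) X Y + \<Delta> * (f1 \<and>\<^sub>f f3) X Y" for X Y
    using d_Re_w3[OF dw3, of l' X Y] unfolding l2
    by (simp add: f ce_d_def wedge_def algebra_simps)
  ultimately have "normal_coframe br (- 2 * D / n) \<Delta> f1 f2 f3 f4 f5 f6"
    using D n0 by (simp add: normal_coframe_def n_def)
  with D show ?thesis
    unfolding \<Delta>_def by (rule that)
qed

theorem proposition2p19:
  fixes br :: "'g::real_vector \<Rightarrow> 'g \<Rightarrow> 'g"
    and J :: "'g \<Rightarrow> 'g"
    and w1 w2 w3 :: "'g \<Rightarrow> complex"
    and B :: complex and c :: real
  assumes "lie_algebra br"
    and "dim (UNIV :: 'g set) = 6"
    and "nilpotent_step br 3"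
    and "complex_structure br J"
    and "basis10 J w1 w2 w3"
    and "ce_d br w1 = (\<lambda>X Y. 0)"
    and "ce_d br w2 = w1 \<and>\<^sub>f conj_form w1"
    and "ce_d br w3 = (\<lambda>X Y. (w1 \<and>\<^sub>f w2) X Y + B * (w1 \<and>\<^sub>f conj_form w2) X Y
            + complex_of_real c * (w2 \<and>\<^sub>f conj_form w1) X Y)"
    and "c \<ge> 0"
    and "c \<noteq> cmod (B - 1)"
    and "(c, cmod B) \<noteq> (0, 1)"
  shows "(lie_isomorphic br h13 \<longleftrightarrow>
            c ^ 4 - 2 * ((cmod B)\<^sup>2 + 1) * c\<^sup>2 + ((cmod B)\<^sup>2 - 1)\<^sup>2 < 0) \<and>
         (lie_isomorphic br h14 \<longleftrightarrow>
            c ^ 4 - 2 * ((cmod B)\<^sup>2 + 1) * c\<^sup>2 + ((cmod B)\<^sup>2 - 1)\<^sup>2 = 0) \<and>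
         (lie_isomorphic br h15 \<longleftrightarrow>
            c ^ 4 - 2 * ((cmod B)\<^sup>2 + 1) * c\<^sup>2 + ((cmod B)\<^sup>2 - 1)\<^sup>2 > 0)"
proof -
  define E where "E = c ^ 4 - 2 * ((cmod B)\<^sup>2 + 1) * c\<^sup>2 + ((cmod B)\<^sup>2 - 1)\<^sup>2"
  obtain D k f1 f2 f3 f4 f5 f6 where D: "D \<noteq> 0"
    and n: "normal_coframe br k (- (E / D\<^sup>2)) f1 f2 f3 f4 f5 f6"
    using exists_normal_coframe[OF assms(2,4-11)] unfolding E_def by blast
  have "lie_isomorphic br h13" if "E < 0"
    using that n D by (intro normal_coframe_pos[of br k "sqrt (- (E / D\<^sup>2))"])
      (auto simp: divide_nonpos_pos divide_le_0_iff)
  moreover have "lie_isomorphic br h14" if "E = 0"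
    using that n by (auto intro: normal_coframe_zero)
  moreover have "lie_isomorphic br h15" if "E > 0"
    using that n D by (intro normal_coframe_neg[of br k "sqrt (E / D\<^sup>2)"]) auto
  \<comment> \<open>The three signs of \<open>E\<close> are exhaustive, so pairwise exclusion of the
    algebras supplies the converses.\<close>
  ultimately show ?thesis
    using lie_isomorphic_exclusive[of br] unfolding E_def[symmetric]
    by (metis linorder_less_linear less_irrefl)
qed

end
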